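(* Let $d$ and $\rho$ be metrics on a set $M$ inducing the same topology $\tau_M$ on $M$, and suppose that $(M,\tau_M)$ is locally compact. Let $\varphi:G\times M\to M$ be a left action by homeomorphisms of a topological group $G$ on $M$, and let $X$ be a non-empty compact subset of $M$. Then $d_X$ and $\rho_X$ induce the same topology on $G/H_X$.
   Context: An action is by homeomorphisms if each map $x\mapsto gx$ is a homeomorphism of $(M,\tau_M)$. $H_X=\{g\in G:gX=X\}$ is the isotropy subgroup of $X$. For a metric $d$ on $M$, the induced Hausdorff metric on $G/H_X$ is $d_X(g_1H_X,g_2H_X)=d_H(g_1X,g_2X)$, where $d_H(A,B)=\max\{\sup_{a\in A}d(a,B),\sup_{b\in B}d(b,A)\}$ is the Hausdorff distance with respect to $d$; $\rho_X$ is defined in the same way from $\rho$. *)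

theory Defs
  imports
    "HOL-Analysis.Analysis"
    "HOL-Algebra.Group_Action"
    "HOL-Algebra.Left_Coset"
begin

section \<open>Topological groups\<close>

text \<open>No separation axiom is imposed on the topology of the group.\<close>

locale topological_group = group G for G (structure) +
  fixes T :: "'a topology"
  assumes topspace_eq_carrier: "topspace T = carrier G"
    and continuous_mult: "continuous_map (prod_topology T T) T (\<lambda>(x, y). x \<otimes> y)"
    and continuous_inv: "continuous_map T T (\<lambda>x. inv x)"


section \<open>Actions by homeomorphisms\<close>

text \<open>
  The action is only required to be continuous in the second variable: neither joint
  continuity nor continuity in the group variable is assumed.
\<close>

definition acts_by_homeomorphisms ::
    "('g, 'r) monoid_scheme \<Rightarrow> 'a topology \<Rightarrow> ('g \<Rightarrow> 'a \<Rightarrow> 'a) \<Rightarrow> bool" where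
  "acts_by_homeomorphisms G \<tau> \<phi> \<longleftrightarrow>
     group_action G (topspace \<tau>) \<phi> \<and> (\<forall>g\<in>carrier G. homeomorphic_map \<tau> \<tau> (\<phi> g))"

definition isotropy_subgroup ::
    "('g, 'r) monoid_scheme \<Rightarrow> ('g \<Rightarrow> 'a \<Rightarrow> 'a) \<Rightarrow> 'a set \<Rightarrow> 'g set" where
  "isotropy_subgroup G \<phi> X = {g \<in> carrier G. \<phi> g ` X = X}"


section \<open>The Hausdorff distance and the induced metric on cosets\<close>

text \<open>
  Infima and suprema are taken in the reals, so these are meaningful only for non-empty
  sets and, in the case of the Hausdorff distance, bounded ones.
\<close>

definition point_set_dist :: "('a \<Rightarrow> 'a \<Rightarrow> real) \<Rightarrow> 'a \<Rightarrow> 'a set \<Rightarrow> real" where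
  "point_set_dist d a B = (INF b\<in>B. d a b)"

definition hausdorff_dist :: "('a \<Rightarrow> 'a \<Rightarrow> real) \<Rightarrow> 'a set \<Rightarrow> 'a set \<Rightarrow> real" where
  "hausdorff_dist d A B =
     max (SUP a\<in>A. point_set_dist d a B) (SUP b\<in>B. point_set_dist d b A)"

text \<open>
  For a left coset \<open>C = gH\<close> of the isotropy subgroup of \<open>X\<close>, every element of \<open>C\<close> moves
  \<open>X\<close> to the same set \<open>gX\<close>, which is thus the only element of the image below; see
  \<open>coset_image_l_coset\<close>.
\<close>

definition coset_image :: "('g \<Rightarrow> 'a \<Rightarrow> 'a) \<Rightarrow> 'a set \<Rightarrow> 'g set \<Rightarrow> 'a set" where
  "coset_image \<phi> X C = the_elem ((\<lambda>g. \<phi> g ` X) ` C)"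

text \<open>
  The value \<open>0\<close> off the coset space is a convention only: \<open>Metric_space\<close> asks for
  non-negativity and symmetry on the whole type.
\<close>

definition coset_dist ::
    "('g, 'r) monoid_scheme \<Rightarrow> ('g \<Rightarrow> 'a \<Rightarrow> 'a) \<Rightarrow> 'a set \<Rightarrow> ('a \<Rightarrow> 'a \<Rightarrow> real) \<Rightarrow>
     'g set \<Rightarrow> 'g set \<Rightarrow> real" where
  "coset_dist G \<phi> X d C1 C2 =
     (if C1 \<in> lcosets\<^bsub>G\<^esub> (isotropy_subgroup G \<phi> X) \<and> C2 \<in> lcosets\<^bsub>G\<^esub> (isotropy_subgroup G \<phi> X)
      then hausdorff_dist d (coset_image \<phi> X C1) (coset_image \<phi> X C2)
      else 0)"


subsection \<open>Well-definedness on cosets\<close>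

lemma (in group_action) action_image_mult:
  assumes "X \<subseteq> E" "g \<in> carrier G" "h \<in> carrier G"
  shows "\<phi> (g \<otimes> h) ` X = \<phi> g ` (\<phi> h ` X)"
  using assms composition_rule by (auto simp: image_image intro!: image_cong)

lemma (in group_action) action_image_one:
  assumes "X \<subseteq> E"
  shows "\<phi> \<one> ` X = X"
proof -
  have "\<phi> \<one> x = x" if "x \<in> X" for x
    using id_eq_one that assms by (metis restrict_apply' subsetD)
  then show ?thesis by auto
qed

lemma (in group_action) subgroup_isotropy:
  assumes "X \<subseteq> E"
  shows "subgroup (isotropy_subgroup G \<phi> X) G"
proof -
  interpret group G using group_hom group_hom.axioms(1) by blast
  show ?thesis
  proof (rule subgroupI)
    show "isotropy_subgroup G \<phi> X \<subseteq> carrier G"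
      by (auto simp: isotropy_subgroup_def)
    show "isotropy_subgroup G \<phi> X \<noteq> {}"
      using action_image_one[OF assms] by (auto simp: isotropy_subgroup_def)
  next
    fix a assume "a \<in> isotropy_subgroup G \<phi> X"
    then have a: "a \<in> carrier G" "\<phi> a ` X = X" by (auto simp: isotropy_subgroup_def)
    have "\<phi> (inv a) ` X = \<phi> (inv a \<otimes> a) ` X"
      using a action_image_mult[OF assms, of "inv a" a] by (simp del: l_inv)
    with a show "inv a \<in> isotropy_subgroup G \<phi> X"
      using action_image_one[OF assms] by (simp add: isotropy_subgroup_def)
  next
    fix a b assume "a \<in> isotropy_subgroup G \<phi> X" "b \<in> isotropy_subgroup G \<phi> X"
    then show "a \<otimes> b \<in> isotropy_subgroup G \<phi> X"
      using action_image_mult[OF assms] by (simp add: isotropy_subgroup_def)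
  qed
qed

lemma (in group_action) coset_image_l_coset:
  assumes "X \<subseteq> E" "g \<in> carrier G"
  shows "coset_image \<phi> X (g <# isotropy_subgroup G \<phi> X) = \<phi> g ` X"
proof -
  have "\<phi> k ` X = \<phi> g ` X" if k: "k \<in> g <# isotropy_subgroup G \<phi> X" for k
  proof -
    obtain h where "h \<in> carrier G" "\<phi> h ` X = X" "k = g \<otimes> h"
      using k by (auto simp: l_coset_def isotropy_subgroup_def)
    then show ?thesis using action_image_mult[OF assms] by simp
  qed
  moreover have "g <# isotropy_subgroup G \<phi> X \<noteq> {}"
    using subgroup.one_closed[OF subgroup_isotropy[OF assms(1)]] by (auto simp: l_coset_def)
  ultimately have "(\<lambda>k. \<phi> k ` X) ` (g <# isotropy_subgroup G \<phi> X) = {\<phi> g ` X}"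
    by blast
  then show ?thesis by (simp add: coset_image_def)
qed

lemma (in group_action) coset_dist_l_coset:
  assumes "X \<subseteq> E" "g1 \<in> carrier G" "g2 \<in> carrier G"
  shows "coset_dist G \<phi> X d (g1 <# isotropy_subgroup G \<phi> X) (g2 <# isotropy_subgroup G \<phi> X)
       = hausdorff_dist d (\<phi> g1 ` X) (\<phi> g2 ` X)"
  using assms by (auto simp: coset_dist_def coset_image_l_coset LCOSETS_def)

lemma (in group_action) l_coset_eq_if_image_eq:
  assumes X: "X \<subseteq> E" and g: "g1 \<in> carrier G" "g2 \<in> carrier G" and eq: "\<phi> g1 ` X = \<phi> g2 ` X"
  shows "g1 <# isotropy_subgroup G \<phi> X = g2 <# isotropy_subgroup G \<phi> X"
proof -
  interpret group G using group_hom group_hom.axioms(1) by blast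
  have "\<phi> (inv g1 \<otimes> g2) ` X = \<phi> (inv g1 \<otimes> g1) ` X"
    using g eq action_image_mult[OF X, of "inv g1" g2] action_image_mult[OF X, of "inv g1" g1]
    by (simp del: l_inv)
  then have "inv g1 \<otimes> g2 \<in> isotropy_subgroup G \<phi> X"
    using g action_image_one[OF X] by (simp add: isotropy_subgroup_def)
  then have "g2 \<in> g1 <# isotropy_subgroup G \<phi> X"
    using g by (force simp: l_coset_def m_assoc[symmetric])
  then show ?thesis
    using l_repr_independence g subgroup_isotropy[OF X] by blast
qed


subsection \<open>The Hausdorff distance is a metric on non-empty compact sets\<close>

context Metric_space
begin

lemma point_set_dist_le:
  assumes "b \<in> B"
  shows "point_set_dist d a B \<le> d a b"
  unfolding point_set_dist_def
  by (rule cINF_lower[OF _ assms]) (auto intro: bdd_belowI[where m = 0])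

lemma point_set_dist_nonneg:
  assumes "B \<noteq> {}"
  shows "0 \<le> point_set_dist d a B"
  unfolding point_set_dist_def by (rule cINF_greatest[OF assms]) auto

lemma bdd_above_point_set_dist:
  assumes A: "compactin mtopology A" and B: "compactin mtopology B" "B \<noteq> {}"
  shows "bdd_above ((\<lambda>a. point_set_dist d a B) ` A)"
proof -
  obtain b where b: "b \<in> B" using B by blast
  have bM: "b \<in> M" using B b compactin_subset_topspace by fastforce
  obtain x r where xr: "A \<subseteq> mcball x r"
    using compactin_imp_mbounded[OF A] by (auto simp: mbounded_def)
  have "point_set_dist d a B \<le> r + d x b" if "a \<in> A" for a
  proof -
    have "x \<in> M" "a \<in> M" "d x a \<le> r" using xr that by auto
    moreover have "d a b \<le> d a x + d x b" using calculation bM triangle by blast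
    ultimately show ?thesis using point_set_dist_le[OF b, of a] commute[of a x] by linarith
  qed
  then show ?thesis by (auto intro!: bdd_aboveI)
qed

lemma hausdorff_dist_le_iff:
  assumes A: "compactin mtopology A" "A \<noteq> {}" and B: "compactin mtopology B" "B \<noteq> {}"
  shows "hausdorff_dist d A B \<le> r \<longleftrightarrow>
           (\<forall>a\<in>A. point_set_dist d a B \<le> r) \<and> (\<forall>b\<in>B. point_set_dist d b A \<le> r)"
  using assms by (simp add: hausdorff_dist_def cSUP_le_iff bdd_above_point_set_dist)

lemma hausdorff_dist_commute: "hausdorff_dist d A B = hausdorff_dist d B A"
  by (simp add: hausdorff_dist_def max.commute)

lemma point_set_dist_triangle:
  assumes B: "compactin mtopology B" "B \<noteq> {}" and C: "compactin mtopology C" "C \<noteq> {}"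
    and a: "a \<in> M"
  shows "point_set_dist d a C \<le> point_set_dist d a B + hausdorff_dist d B C"
proof -
  have sub: "B \<subseteq> M" "C \<subseteq> M" using B C compactin_subset_topspace by fastforce+
  have "point_set_dist d a C - hausdorff_dist d B C \<le> d a b" if b: "b \<in> B" for b
  proof -
    have "point_set_dist d a C - d a b \<le> d b c" if c: "c \<in> C" for c
      using point_set_dist_le[OF c, of a] triangle[of a b c] a b c sub by fastforce
    then have "point_set_dist d a C - d a b \<le> point_set_dist d b C"
      unfolding point_set_dist_def[of d b C] by (intro cINF_greatest C)
    moreover have "point_set_dist d b C \<le> hausdorff_dist d B C"
      using hausdorff_dist_le_iff[OF B C] b by blast
    ultimately show ?thesis by linarith
  qed
  then have "point_set_dist d a C - hausdorff_dist d B C \<le> point_set_dist d a B"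
    unfolding point_set_dist_def[of d a B] by (intro cINF_greatest B)
  then show ?thesis by linarith
qed

lemma mem_if_point_set_dist_le_0:
  assumes B: "compactin mtopology B" "B \<noteq> {}" and a: "a \<in> M" and le: "point_set_dist d a B \<le> 0"
  shows "a \<in> B"
proof (rule ccontr)
  assume "a \<notin> B"
  have "closedin mtopology B"
    using B(1) Hausdorff_space_mtopology compactin_imp_closedin by blast
  with \<open>a \<notin> B\<close> a obtain r where r: "r > 0" "disjnt B (mball a r)"
    unfolding closedin_metric by blast
  have "r \<le> d a b" if "b \<in> B" for b
  proof -
    have "b \<in> M" using B that compactin_subset_topspace by fastforce
    with r that a show ?thesis by (force simp: disjnt_def)
  qed
  then have "r \<le> point_set_dist d a B"
    unfolding point_set_dist_def by (intro cINF_greatest B)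
  with le r show False by linarith
qed

lemma hausdorff_dist_nonneg:
  assumes A: "compactin mtopology A" "A \<noteq> {}" and B: "compactin mtopology B" "B \<noteq> {}"
  shows "0 \<le> hausdorff_dist d A B"
proof -
  obtain a where a: "a \<in> A" using A by blast
  have "0 \<le> point_set_dist d a B" by (rule point_set_dist_nonneg[OF B(2)])
  also have "\<dots> \<le> hausdorff_dist d A B"
    using hausdorff_dist_le_iff[OF A B] a by blast
  finally show ?thesis .
qed

lemma hausdorff_dist_eq_0_iff:
  assumes A: "compactin mtopology A" "A \<noteq> {}" and B: "compactin mtopology B" "B \<noteq> {}"
  shows "hausdorff_dist d A B = 0 \<longleftrightarrow> A = B"
proof
  have sub: "A \<subseteq> M" "B \<subseteq> M" using A B compactin_subset_topspace by fastforce+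
  assume "hausdorff_dist d A B = 0"
  then have "\<forall>a\<in>A. point_set_dist d a B \<le> 0" "\<forall>b\<in>B. point_set_dist d b A \<le> 0"
    using hausdorff_dist_le_iff[OF A B, of 0] by simp_all
  then show "A = B"
    using mem_if_point_set_dist_le_0[OF A] mem_if_point_set_dist_le_0[OF B] sub by blast
next
  assume eq: "A = B"
  have "point_set_dist d a A \<le> 0" if "a \<in> A" for a
  proof -
    have "a \<in> M" using A that compactin_subset_topspace by fastforce
    then show ?thesis using point_set_dist_le[OF that, of a] by simp
  qed
  then have "hausdorff_dist d A B \<le> 0"
    using hausdorff_dist_le_iff[OF A A] eq by blast
  then show "hausdorff_dist d A B = 0"
    using hausdorff_dist_nonneg[OF A B] by linarith
qed

lemma hausdorff_dist_triangle:
  assumes A: "compactin mtopology A" "A \<noteq> {}" and B: "compactin mtopology B" "B \<noteq> {}"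
    and C: "compactin mtopology C" "C \<noteq> {}"
  shows "hausdorff_dist d A C \<le> hausdorff_dist d A B + hausdorff_dist d B C"
proof -
  have sub: "A \<subseteq> M" "C \<subseteq> M" using A C compactin_subset_topspace by fastforce+
  have 1: "point_set_dist d a C \<le> hausdorff_dist d A B + hausdorff_dist d B C" if "a \<in> A" for a
  proof -
    have "point_set_dist d a B \<le> hausdorff_dist d A B"
      using hausdorff_dist_le_iff[OF A B] that by blast
    moreover have "point_set_dist d a C \<le> point_set_dist d a B + hausdorff_dist d B C"
      using point_set_dist_triangle[OF B C] sub that by blast
    ultimately show ?thesis by linarith
  qed
  have 2: "point_set_dist d c A \<le> hausdorff_dist d A B + hausdorff_dist d B C" if "c \<in> C" for c
  proof -
    have "point_set_dist d c B \<le> hausdorff_dist d B C"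
      using hausdorff_dist_le_iff[OF B C] that by blast
    moreover have "point_set_dist d c A \<le> point_set_dist d c B + hausdorff_dist d A B"
      using point_set_dist_triangle[OF B A] sub that hausdorff_dist_commute[of A B] by auto
    ultimately show ?thesis by linarith
  qed
  show ?thesis using hausdorff_dist_le_iff[OF A C] 1 2 by blast
qed

end


subsection \<open>The induced metric on the coset space\<close>

lemma Metric_space_coset_dist:
  fixes G :: "('g, 'r) monoid_scheme" and X :: "'a set"
  assumes M: "Metric_space M d"
    and act: "acts_by_homeomorphisms G (Metric_space.mtopology M d) \<phi>"
    and X: "compactin (Metric_space.mtopology M d) X" "X \<noteq> {}"
  shows "Metric_space (lcosets\<^bsub>G\<^esub> (isotropy_subgroup G \<phi> X)) (coset_dist G \<phi> X d)"
proof -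
  interpret Metric_space M d by (rule M)
  interpret group_action G M \<phi>
    using act by (simp add: acts_by_homeomorphisms_def)
  have XM: "X \<subseteq> M" using X compactin_subset_topspace by fastforce
  let ?L = "lcosets\<^bsub>G\<^esub> (isotropy_subgroup G \<phi> X)"
  have img: "compactin mtopology (coset_image \<phi> X C)" "coset_image \<phi> X C \<noteq> {}"
    if C_in: "C \<in> ?L" for C
  proof -
    obtain g where g: "g \<in> carrier G" and C: "C = g <#\<^bsub>G\<^esub> isotropy_subgroup G \<phi> X"
      using C_in by (auto simp: LCOSETS_def)
    have "continuous_map mtopology mtopology (\<phi> g)"
      using act g by (auto simp: acts_by_homeomorphisms_def homeomorphic_imp_continuous_map)
    then show "compactin mtopology (coset_image \<phi> X C)" "coset_image \<phi> X C \<noteq> {}"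
      using image_compactin[OF X(1)] X(2) coset_image_l_coset[OF XM g] unfolding C by simp_all
  qed
  have inj: "C = D" if CD: "C \<in> ?L" "D \<in> ?L" "coset_image \<phi> X C = coset_image \<phi> X D" for C D
  proof -
    obtain g h where g: "g \<in> carrier G" "C = g <#\<^bsub>G\<^esub> isotropy_subgroup G \<phi> X"
      and h: "h \<in> carrier G" "D = h <#\<^bsub>G\<^esub> isotropy_subgroup G \<phi> X"
      using CD(1,2) unfolding LCOSETS_def by blast
    have "\<phi> g ` X = \<phi> h ` X"
      using CD(3) coset_image_l_coset[OF XM g(1)] coset_image_l_coset[OF XM h(1)] g(2) h(2)
      by metis
    then show ?thesis
      using l_coset_eq_if_image_eq[OF XM g(1) h(1)] g(2) h(2) by metis
  qed
  show ?thesis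
  proof
    show "0 \<le> coset_dist G \<phi> X d C D" for C D
      using img hausdorff_dist_nonneg by (simp add: coset_dist_def)
    show "coset_dist G \<phi> X d C D = coset_dist G \<phi> X d D C" for C D
      using hausdorff_dist_commute unfolding coset_dist_def by auto
    show "coset_dist G \<phi> X d C D = 0 \<longleftrightarrow> C = D" if "C \<in> ?L" "D \<in> ?L" for C D
    proof -
      have "coset_dist G \<phi> X d C D = 0 \<longleftrightarrow> coset_image \<phi> X C = coset_image \<phi> X D"
        unfolding coset_dist_def using that hausdorff_dist_eq_0_iff[OF img img] by simp
      then show ?thesis using inj[OF that] by blast
    qed
    show "coset_dist G \<phi> X d C E \<le> coset_dist G \<phi> X d C D + coset_dist G \<phi> X d D E"
      if "C \<in> ?L" "D \<in> ?L" "E \<in> ?L" for C D E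
      unfolding coset_dist_def using that
      by (simp only: simp_thms if_True) (intro hausdorff_dist_triangle img; assumption)
  qed
qed

end

theory Submission
  imports Defs
begin

text \<open>
  The Hausdorff topology on the non-empty compact sets depends only on the topology of the
  underlying space: by a Lebesgue number argument, the identity from \<open>d\<close> to \<open>\<rho>\<close> is uniformly
  continuous at the points of a compact set \<open>A\<close> (the second point need not lie in
  \<open>A\<close>), so that sets which are \<open>d\<close>-close to \<open>A\<close> are also \<open>\<rho>\<close>-close to \<open>A\<close>.
\<close>

lemma uniformly_close_on_compactin:
  assumes d: "Metric_space M d" and \<rho>: "Metric_space M \<rho>"
    and eq: "Metric_space.mtopology M d = Metric_space.mtopology M \<rho>"
    and A: "compactin (Metric_space.mtopology M d) A" and "e > 0"
  obtains \<delta> where "\<delta> > 0" "\<And>x y. \<lbrakk>x \<in> A; y \<in> M; d x y < \<delta>\<rbrakk> \<Longrightarrow> \<rho> x y < e"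
proof -
  interpret d: Metric_space M d by (rule d)
  interpret \<rho>: Metric_space M \<rho> by (rule \<rho>)
  have AM: "A \<subseteq> M" using A compactin_subset_topspace by fastforce
  \<comment> \<open>The radius is halved because \<open>x\<close> and \<open>y\<close> will share a
    ball centred at some third point \<open>a\<close>. These \<open>\<rho>\<close>-balls are also
    \<open>d\<close>-open by \<open>eq\<close>, which is where the common topology enters.\<close>
  let ?\<C> = "(\<lambda>a. \<rho>.mball a (e/2)) ` A"
  have cover: "A \<subseteq> \<Union> ?\<C>"
    using AM \<open>e > 0\<close> by auto
  have opens: "openin d.mtopology U" if "U \<in> ?\<C>" for U
    using that eq by auto
  obtain \<delta> where "\<delta> > 0" and \<delta>: "\<forall>x\<in>A. \<exists>U\<in>?\<C>. d.mball x \<delta> \<subseteq> U"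
    using d.lebesgue_number[OF A cover opens] by blast
  have "\<rho> x y < e" if xy: "x \<in> A" "y \<in> M" "d x y < \<delta>" for x y
  proof -
    obtain a where sub: "d.mball x \<delta> \<subseteq> \<rho>.mball a (e/2)"
      using \<delta> xy(1) by blast
    have "x \<in> M" using xy(1) AM by blast
    then have "x \<in> \<rho>.mball a (e/2)" "y \<in> \<rho>.mball a (e/2)"
      using sub xy \<open>\<delta> > 0\<close> d.in_mball d.centre_in_mball_iff by blast+
    \<comment> \<open>Membership in the ball also supplies \<open>a \<in> M\<close>, as the triangle
      inequality through \<open>a\<close> requires.\<close>
    then show ?thesis
      using \<rho>.triangle[of x a y] \<rho>.commute[of x a] by simp
  qed
  with \<open>\<delta> > 0\<close> that show ?thesis by blast
qed

text \<open>The infimum over \<open>B\<close> of the distances from \<open>a\<close> is at most the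
  Hausdorff distance, hence strictly below \<open>r\<close>, so some point of \<open>B\<close>
  already has distance less than \<open>r\<close>.\<close>

lemma (in Metric_space) exists_close_if_hausdorff_dist_less:
  assumes A: "compactin mtopology A" "A \<noteq> {}" and B: "compactin mtopology B" "B \<noteq> {}"
    and less: "hausdorff_dist d A B < r" and a: "a \<in> A"
  obtains b where "b \<in> B" "d a b < r"
proof -
  have "point_set_dist d a B \<le> hausdorff_dist d A B"
    using hausdorff_dist_le_iff[OF A B] a by blast
  with less have "(INF b\<in>B. d a b) < r"
    by (simp add: point_set_dist_def)
  moreover have "bdd_below (d a ` B)"
    by (auto intro: bdd_belowI[where m = 0])
  ultimately show ?thesis
    using that B(2) by (auto simp: cINF_less_iff)
qed

text \<open>The \<open>\<delta>\<close> depends on \<open>A\<close> but not on \<open>B\<close>. One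
  \<open>\<delta>\<close> handles both suprema because every pair of nearby points that is compared
  has one member in \<open>A\<close>.\<close>

lemma hausdorff_dist_comparison:
  assumes d: "Metric_space M d" and \<rho>: "Metric_space M \<rho>"
    and eq: "Metric_space.mtopology M d = Metric_space.mtopology M \<rho>"
    and A: "compactin (Metric_space.mtopology M d) A" "A \<noteq> {}" and "e > 0"
  obtains \<delta> where "\<delta> > 0"
    "\<And>B. \<lbrakk>compactin (Metric_space.mtopology M d) B; B \<noteq> {}; hausdorff_dist d A B < \<delta>\<rbrakk>
          \<Longrightarrow> hausdorff_dist \<rho> A B < e"
proof -
  interpret d: Metric_space M d by (rule d)
  interpret \<rho>: Metric_space M \<rho> by (rule \<rho>)
  \<comment> \<open>Passing to the supremum loses strictness; aiming at \<open>e/2\<close> restores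
    a strict bound by \<open>e\<close>.\<close>
  have "e/2 > 0" using \<open>e > 0\<close> by simp
  then obtain \<delta> where "\<delta> > 0" and \<delta>: "\<And>x y. \<lbrakk>x \<in> A; y \<in> M; d x y < \<delta>\<rbrakk> \<Longrightarrow> \<rho> x y < e/2"
    using uniformly_close_on_compactin[OF d \<rho> eq A(1)] by blast
  have "hausdorff_dist \<rho> A B < e"
    if B: "compactin d.mtopology B" "B \<noteq> {}" and less: "hausdorff_dist d A B < \<delta>" for B
  proof -
    have BM: "B \<subseteq> M" using B compactin_subset_topspace by fastforce
    have "point_set_dist \<rho> a B \<le> e/2" if a: "a \<in> A" for a
    proof -
      obtain b where b: "b \<in> B" "d a b < \<delta>"
        using d.exists_close_if_hausdorff_dist_less[OF A B less a] by blast
      then have "\<rho> a b < e/2" using \<delta> a BM by blast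
      then show ?thesis using \<rho>.point_set_dist_le[OF b(1), of a] by linarith
    qed
    moreover have "point_set_dist \<rho> b A \<le> e/2" if b: "b \<in> B" for b
    proof -
      obtain a where a: "a \<in> A" "d b a < \<delta>"
        using d.exists_close_if_hausdorff_dist_less[OF B A _ b, of \<delta>] less
        by (metis d.hausdorff_dist_commute)
      \<comment> \<open>The pair is turned around: the choice of \<open>\<delta>\<close> is uniform
        only when the first point lies in \<open>A\<close>.\<close>
      then have "\<rho> a b < e/2" using \<delta> b BM d.commute by (metis subsetD)
      then show ?thesis
        using \<rho>.point_set_dist_le[OF a(1), of b] \<rho>.commute[of a b] by linarith
    qed
    ultimately have "hausdorff_dist \<rho> A B \<le> e/2"
      using \<rho>.hausdorff_dist_le_iff[of A B "e/2"] A B eq by simp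
    then show ?thesis using \<open>e > 0\<close> by linarith
  qed
  with \<open>\<delta> > 0\<close> that show ?thesis by blast
qed

text \<open>Each coset yields a translate of \<open>X\<close> under a continuous map. Phrasing this
  through \<open>\<tau>\<close> lets it serve both metrics.\<close>

lemma compactin_coset_image:
  assumes act: "acts_by_homeomorphisms G \<tau> \<phi>" and X: "compactin \<tau> X" "X \<noteq> {}"
    and C: "C \<in> lcosets\<^bsub>G\<^esub> (isotropy_subgroup G \<phi> X)"
  shows "compactin \<tau> (coset_image \<phi> X C)" "coset_image \<phi> X C \<noteq> {}"
proof -
  interpret group_action G "topspace \<tau>" \<phi>
    using act by (simp add: acts_by_homeomorphisms_def)
  obtain g where g: "g \<in> carrier G" and C: "C = g <#\<^bsub>G\<^esub> isotropy_subgroup G \<phi> X"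
    using C by (auto simp: LCOSETS_def)
  have "continuous_map \<tau> \<tau> (\<phi> g)"
    using act g by (auto simp: acts_by_homeomorphisms_def homeomorphic_imp_continuous_map)
  then show "compactin \<tau> (coset_image \<phi> X C)" "coset_image \<phi> X C \<noteq> {}"
    using image_compactin[OF X(1)] X(2)
      coset_image_l_coset[OF compactin_subset_topspace[OF X(1)] g] C by simp_all
qed

text \<open>This is one inclusion between the two topologies: the identity on cosets is continuous
  from the metric of \<open>d\<close> to that of \<open>\<rho>\<close>.\<close>

lemma openin_coset_dist_mono:
  assumes d: "Metric_space M d" and \<rho>: "Metric_space M \<rho>"
    and eq: "Metric_space.mtopology M d = \<tau>" "Metric_space.mtopology M \<rho> = \<tau>"
    and act: "acts_by_homeomorphisms G \<tau> \<phi>" and X: "compactin \<tau> X" "X \<noteq> {}"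
    and U: "openin (Metric_space.mtopology (lcosets\<^bsub>G\<^esub> (isotropy_subgroup G \<phi> X))
                     (coset_dist G \<phi> X \<rho>)) U"
  shows "openin (Metric_space.mtopology (lcosets\<^bsub>G\<^esub> (isotropy_subgroup G \<phi> X))
                  (coset_dist G \<phi> X d)) U"
proof -
  let ?L = "lcosets\<^bsub>G\<^esub> (isotropy_subgroup G \<phi> X)"
  interpret D: Metric_space ?L "coset_dist G \<phi> X d"
    using Metric_space_coset_dist[OF d, of G \<phi> X] eq act X by simp
  interpret R: Metric_space ?L "coset_dist G \<phi> X \<rho>"
    using Metric_space_coset_dist[OF \<rho>, of G \<phi> X] eq act X by simp
  \<comment> \<open>Here \<open>\<delta>\<close> may vary with \<open>C\<close>: pointwise
    continuity suffices to compare topologies.\<close>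
  have "\<exists>\<delta>>0. \<forall>D. D \<in> ?L \<and> coset_dist G \<phi> X d C D < \<delta> \<longrightarrow> coset_dist G \<phi> X \<rho> C D < e"
    if C: "C \<in> ?L" and "e > 0" for C e
  proof -
    note img = compactin_coset_image[OF act X]
    obtain \<delta> where "\<delta> > 0" and \<delta>: "\<And>B. \<lbrakk>compactin \<tau> B; B \<noteq> {};
        hausdorff_dist d (coset_image \<phi> X C) B < \<delta>\<rbrakk> \<Longrightarrow> hausdorff_dist \<rho> (coset_image \<phi> X C) B < e"
      using hausdorff_dist_comparison[OF d \<rho>, of "coset_image \<phi> X C" e] img[OF C] \<open>e > 0\<close>
      unfolding eq by blast
    have "coset_dist G \<phi> X \<rho> C D < e" if "D \<in> ?L" "coset_dist G \<phi> X d C D < \<delta>" for D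
      using that C \<delta>[OF img[OF that(1)]] by (simp add: coset_dist_def)
    with \<open>\<delta> > 0\<close> show ?thesis by blast
  qed
  then have "continuous_map D.mtopology R.mtopology id"
    unfolding D.metric_continuous_map[OF R.Metric_space_axioms] by simp
  then show ?thesis
    using U topology_finer_continuous_id[of R.mtopology D.mtopology] by simp
qed

theorem proposition4p6:
  fixes M :: "'a set" and d \<rho> :: "'a \<Rightarrow> 'a \<Rightarrow> real" and \<tau> :: "'a topology"
    and G :: "('g, 'r) monoid_scheme" and T :: "'g topology"
    and \<phi> :: "'g \<Rightarrow> 'a \<Rightarrow> 'a" and X :: "'a set"
  assumes "Metric_space M d" and "Metric_space M \<rho>"
    and "Metric_space.mtopology M d = \<tau>" and "Metric_space.mtopology M \<rho> = \<tau>"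
    and "locally_compact_space \<tau>"
    and "topological_group G T"
    and "acts_by_homeomorphisms G \<tau> \<phi>"
    and "compactin \<tau> X" and "X \<noteq> {}"
  shows "Metric_space.mtopology (lcosets\<^bsub>G\<^esub> (isotropy_subgroup G \<phi> X)) (coset_dist G \<phi> X d)
       = Metric_space.mtopology (lcosets\<^bsub>G\<^esub> (isotropy_subgroup G \<phi> X)) (coset_dist G \<phi> X \<rho>)"
  unfolding topology_eq
  \<comment> \<open>The second instance swaps the roles of \<open>d\<close> and
    \<open>\<rho>\<close>, giving the reverse inclusion.\<close>
  using openin_coset_dist_mono[OF assms(1,2,3,4,7,8,9)]
    openin_coset_dist_mono[OF assms(2,1,4,3,7,8,9)] by blast

end
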